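(* Let $n\in\{2,3\}$, and let $g_1,g_2,g_1',g_2'$ be geometries in $\mathbb{R}^n$ such that $(g_1,g_2)$ and $(g_1',g_2')$ are affine equivalent geometry pairs, i.e., there is a single affine transformation $\mathcal{A}:\mathbb{R}^n\to\mathbb{R}^n$ such that $g_1$ and $g_1'$ are affine equivalent under $\mathcal{A}$ and $g_2$ and $g_2'$ are affine equivalent under the same $\mathcal{A}$. Then $$R(g_1,g_2)=R(g_1',g_2'),$$ where $R$ denotes the $3\times 3$ matrix giving the formal topological relationship (DE-9IM).
   Context: Work in $\mathbb{R}^n$ with $n\in\{2,3\}$. **Affine transformation.** A map $\mathcal{A}(p)=\mathbf{A}p+\mathbf{b}$ with $\mathbf{A}\in\mathbb{R}^{n\times n}$ invertible and $\mathbf{b}\in\mathbb{R}^n$. **Cells.** A $k$-cell ($0\le k\le n$) is a nondegenerate $k$-simplex in $\mathbb{R}^n$, determined by its $k+1$ affinely independent vertices: a $0$-cell is a point, a $1$-cell a line segment, a $2$-cell a triangle, a $3$-cell a tetrahedron. An $r$-face of a $k$-cell $C$ is an $r$-cell whose vertices are among those of $C$, $0\le r\le k$. Cells and faces are regarded as (closed) subsets of $\mathbb{R}^n$. For a $k$-cell $C$: - closure $\overline{C}$: the union of all $r$-faces of $C$ with $0\le r\le k$; - boundary $\partial C$: the union of all $r$-faces of $C$ with $0\le r\le k-1$ (so $\partial C=\emptyset$ if $k=0$); - interior $C^o=\overline{C}\setminus\partial C$; - exterior $C^-=\mathbb{R}^n\setminus\overline{C}$. **Geometries (cell complexes).** A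 geometry $g$ is given by a finite collection of pairwise distinct cells $C_1,\dots,C_x$ ($x\ge 1$) that constitute it (these are "the cells in $g$"). Define - $\partial g=\bigcup_{i=1}^x\partial C_i\ \setminus\ \bigcup_{i=1}^x\bigcup_{j=i+1}^x(\partial C_i\cap\partial C_j)$ (boundary); - $g^o=\bigcup_{i=1}^x\overline{C_i}\ \setminus\ \partial g$ (interior); - $g^-=\bigcap_{i=1}^x C_i^-$ (exterior). **Formal topological relationship.** For a set $S$ arising as an intersection below, $\mathcal{D}[S]=F$ (a fixed symbol) if $S=\emptyset$, and otherwise $\mathcal{D}[S]$ is the dimension of $S$, i.e., the largest $k$ such that $S$ contains a nonempty relatively open subset of some $k$-dimensional affine subspace of $\mathbb{R}^n$. For geometries $g_1,g_2$, $$R(g_1,g_2)=\begin{bmatrix}\mathcal{D}[g_1^o\cap g_2^o]&\mathcal{D}[g_1^o\cap\partial g_2]&\mathcal{D}[g_1^o\cap g_2^-]\\ \mathcal{D}[\partial g_1\cap g_2^o]&\mathcal{D}[\partial g_1\cap\partial g_2]&\mathcal{D}[\partial g_1\cap g_2^-]\\ \mathcal{D}[g_1^-\cap g_2^o]&\mathcal{D}[g_1^-\cap\partial g_2]&\mathcal{D}[g_1^-\cap g_2^-]\end{bmatrix}.$$ **Affine equivalence.** An affine transformation maps a cell $c$ to a cell $c'$ if it maps the vertex set of $c$ onto the vertex set of $c'$. Geometries $g$ and $g'$ are affine equivalent under $\mathcal{A}$ if (1) for every cell $c$ in $g$ there is a cell $c'$ in $g'$ such that $\mathcal{A}$ maps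 $c$ to $c'$, and (2) for every cell $c'$ in $g'$ there is a cell $c$ in $g$ such that $\mathcal{A}^{-1}$ maps $c'$ to $c$. *)

theory Defs
  imports "HOL-Analysis.Analysis"
begin

definition affine_transformation :: "(real^'n \<Rightarrow> real^'n) \<Rightarrow> bool" where
  "affine_transformation T \<longleftrightarrow>
     (\<exists>(A :: real^'n^'n) b. invertible A \<and> T = (\<lambda>p. A *v p + b))"

(* Cells are closed subsets of the space. For a natural number k, "int k simplex C" says that C is
   the convex hull of k + 1 affinely independent points; the library's (-1)-simplex, the empty set,
   is not a cell. *)

definition is_cell :: "nat \<Rightarrow> (real^'n) set \<Rightarrow> bool" where
  "is_cell k C \<longleftrightarrow> k \<le> CARD('n) \<and> int k simplex C"

definition cell_vertices :: "(real^'n) set \<Rightarrow> (real^'n) set" where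
  "cell_vertices C = {v. v extreme_point_of C}"

lemma cell_vertices_convex_hull:
  assumes "\<not> affine_dependent V"
  shows "cell_vertices (convex hull V) = V"
  using extreme_point_of_convex_hull_affine_independent[OF assms]
  by (auto simp: cell_vertices_def)

definition is_cell_face :: "nat \<Rightarrow> (real^'n) set \<Rightarrow> (real^'n) set \<Rightarrow> bool" where
  "is_cell_face r F C \<longleftrightarrow> is_cell r F \<and> cell_vertices F \<subseteq> cell_vertices C"

(* For a k-cell C, aff_dim C = k (lemma aff_dim_simplex). *)

definition cell_closure :: "(real^'n) set \<Rightarrow> (real^'n) set" where
  "cell_closure C = \<Union>{F. \<exists>r. int r \<le> aff_dim C \<and> is_cell_face r F C}"

definition cell_boundary :: "(real^'n) set \<Rightarrow> (real^'n) set" where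
  "cell_boundary C = \<Union>{F. \<exists>r. int r \<le> aff_dim C - 1 \<and> is_cell_face r F C}"

definition cell_interior :: "(real^'n) set \<Rightarrow> (real^'n) set" where
  "cell_interior C = cell_closure C - cell_boundary C"

definition cell_exterior :: "(real^'n) set \<Rightarrow> (real^'n) set" where
  "cell_exterior C = UNIV - cell_closure C"

(* A geometry is the list of its cells in some order; the cell with 1-based index i + 1 is g ! i. *)

definition geometry :: "(real^'n) set list \<Rightarrow> bool" where
  "geometry g \<longleftrightarrow> length g \<ge> 1 \<and> distinct g \<and> (\<forall>C\<in>set g. \<exists>k. is_cell k C)"

definition geom_boundary :: "(real^'n) set list \<Rightarrow> (real^'n) set" where
  "geom_boundary g =
     (\<Union>i<length g. cell_boundary (g ! i)) -
     (\<Union>i<length g. \<Union>j\<in>{i<..<length g}. cell_boundary (g ! i) \<inter> cell_boundary (g ! j))"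

definition geom_interior :: "(real^'n) set list \<Rightarrow> (real^'n) set" where
  "geom_interior g = (\<Union>i<length g. cell_closure (g ! i)) - geom_boundary g"

definition geom_exterior :: "(real^'n) set list \<Rightarrow> (real^'n) set" where
  "geom_exterior g = (\<Inter>i<length g. cell_exterior (g ! i))"

definition contains_open_of_dim :: "(real^'n) set \<Rightarrow> nat \<Rightarrow> bool" where
  "contains_open_of_dim S k \<longleftrightarrow>
     (\<exists>A U. affine A \<and> aff_dim A = int k \<and>
        openin (top_of_set A) U \<and> U \<noteq> {} \<and> U \<subseteq> S)"

(* None plays the role of the symbol F for the empty intersection. For nonempty S the greatest
   element exists by the two lemmas below. *)

definition intersection_dim :: "(real^'n) set \<Rightarrow> nat option" where
  "intersection_dim S =
     (if S = {} then None else Some (GREATEST k. contains_open_of_dim S k))"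

lemma contains_open_of_dim_0:
  assumes "S \<noteq> {}"
  shows "contains_open_of_dim S 0"
proof -
  obtain x where "x \<in> S" using assms by blast
  then show ?thesis
    unfolding contains_open_of_dim_def
    by (intro exI[of _ "{x}"]) auto
qed

lemma contains_open_of_dim_le:
  fixes S :: "(real^'n) set"
  assumes "contains_open_of_dim S k"
  shows "k \<le> CARD('n)"
proof -
  obtain A :: "(real^'n) set" where "aff_dim A = int k"
    using assms unfolding contains_open_of_dim_def by blast
  then show ?thesis using aff_dim_le_DIM[of A] by simp
qed

(* In the index type 3, the indices are 1, 2, 3 and 3 = 0. *)

definition geom_part :: "3 \<Rightarrow> (real^'n) set list \<Rightarrow> (real^'n) set" where
  "geom_part i g =
     (if i = 1 then geom_interior g
      else if i = 2 then geom_boundary g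
      else geom_exterior g)"

definition topological_relationship ::
    "(real^'n) set list \<Rightarrow> (real^'n) set list \<Rightarrow> (nat option)^3^3" where
  "topological_relationship g1 g2 =
     (\<chi> i j. intersection_dim (geom_part i g1 \<inter> geom_part j g2))"

definition maps_cell :: "(real^'n \<Rightarrow> real^'n) \<Rightarrow> (real^'n) set \<Rightarrow> (real^'n) set \<Rightarrow> bool" where
  "maps_cell T c c' \<longleftrightarrow> T ` cell_vertices c = cell_vertices c'"

definition affine_equivalent_under ::
    "(real^'n \<Rightarrow> real^'n) \<Rightarrow> (real^'n) set list \<Rightarrow> (real^'n) set list \<Rightarrow> bool" where
  "affine_equivalent_under T g g' \<longleftrightarrow>
     (\<forall>c\<in>set g. \<exists>c'\<in>set g'. maps_cell T c c') \<and>
     (\<forall>c'\<in>set g'. \<exists>c\<in>set g. maps_cell (inv T) c' c)"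

definition affine_equivalent_pairs ::
    "(real^'n) set list \<times> (real^'n) set list \<Rightarrow>
     (real^'n) set list \<times> (real^'n) set list \<Rightarrow> bool" where
  "affine_equivalent_pairs p p' \<longleftrightarrow>
     (\<exists>T. affine_transformation T \<and>
        affine_equivalent_under T (fst p) (fst p') \<and>
        affine_equivalent_under T (snd p) (snd p'))"

end

theory Submission
  imports Defs
begin

text \<open>
  An affine bijection preserves convex hulls, extreme points, affine independence and dimension, so
  it carries the faces of a cell to the faces of the image cell. The boundary of a geometry consists
  of the points lying on the boundary of exactly one of its cells; in this form it depends only on
  the set of cells, not on their order, so the three parts of a geometry are transported as well.
  Finally, an affine bijection maps relatively open subsets of affine subspaces to such sets of the
  same dimension.
\<close>

section \<open>Affine transformations and the notions they preserve\<close>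

lemma affine_transformation_decompose:
  assumes "affine_transformation T"
  obtains f b where "linear f" "bij f" "T = (+) b \<circ> f"
proof -
  obtain A b where "invertible A" "T = (\<lambda>p. A *v p + b)"
    using assms by (auto simp: affine_transformation_def)
  then have "T = (+) b \<circ> (*v) A" "bij ((*v) A)"
    by (auto simp: invertible_eq_bij)
  then show ?thesis
    using that matrix_vector_mul_linear by blast
qed

lemma bij_affine_transformation:
  assumes "affine_transformation T"
  shows "bij T"
proof -
  obtain f b where "bij f" and T: "T = (+) b \<circ> f"
    using affine_transformation_decompose[OF assms] .
  then show ?thesis
    unfolding T by (intro bij_comp bij_plus)
qed

text \<open>Closure under inverses lets the one-directional transport results below be reversed by
  applying them to \<open>inv T\<close>; it also handles the second condition of affine
  equivalence.\<close>

lemma affine_transformation_inv: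
  assumes "affine_transformation T"
  shows "affine_transformation (inv T)"
proof -
  obtain A b where A: "invertible A" and T: "T = (\<lambda>p. A *v p + b)"
    using assms by (auto simp: affine_transformation_def)
  obtain B where AB: "A ** B = mat 1" and BA: "B ** A = mat 1"
    using A by (auto simp: invertible_def)
  have "inv T = (\<lambda>p. B *v p + - (B *v b))"
    by (rule inv_equality)
      (simp_all add: T AB BA matrix_vector_mul_assoc matrix_vector_right_distrib
        matrix_vector_mult_diff_distrib)
  moreover have "invertible B"
    using AB BA by (auto simp: invertible_def)
  ultimately show ?thesis
    unfolding affine_transformation_def by blast
qed

lemma affine_transformation_image:
  assumes "affine_transformation T"
  shows convex_hull_affine_image: "convex hull (T ` S) = T ` (convex hull S)"
    and aff_dim_affine_image: "aff_dim (T ` S) = aff_dim S"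
    and affine_affine_image: "affine S \<Longrightarrow> affine (T ` S)"
    and open_affine_image: "open S \<Longrightarrow> open (T ` S)"
    and extreme_point_of_affine_image: "T x extreme_point_of (T ` S) \<longleftrightarrow> x extreme_point_of S"
proof -
  obtain f b where f: "linear f" "bij f" and T: "T = (+) b \<circ> f"
    using affine_transformation_decompose[OF assms] .
  have inj: "inj f" and surj: "surj f"
    using f by (auto simp: bij_def)
  have image: "T ` X = (+) b ` f ` X" for X
    by (simp add: T image_comp)
  show "convex hull (T ` S) = T ` (convex hull S)"
    unfolding image by (simp add: convex_hull_translation convex_hull_linear_image f)
  show "aff_dim (T ` S) = aff_dim S"
    unfolding image by (simp add: aff_dim_translation_eq aff_dim_injective_linear_image f inj)
  \<comment> \<open>An affine set is its own affine hull, and \<open>f\<close> commutes with affine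
    hulls.\<close>
  show "affine S \<Longrightarrow> affine (T ` S)"
    unfolding image
    by (metis affine_hull_linear_image affine_hull_eq affine_translation f(1)
        linear_conv_bounded_linear)
  show "open S \<Longrightarrow> open (T ` S)"
    unfolding image
    using open_surjective_linear_image[OF _ f(1) surj, of S] open_translation by blast
  \<comment> \<open>An extreme point lies in the set but in no open segment between two points of
    the set, so commuting with open segments and injectivity suffice.\<close>
  have "open_segment (T a) (T c) = T ` open_segment a c" for a c
    unfolding image by (simp add: T open_segment_linear_image[OF f(1) inj] open_segment_translation)
  moreover have "inj T"
    using bij_affine_transformation[OF assms] by (rule bij_is_inj)
  ultimately show "T x extreme_point_of (T ` S) \<longleftrightarrow> x extreme_point_of S"
    by (simp add: extreme_point_of_def inj_image_mem_iff)
qed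

lemma surj_image_eqI:
  assumes "surj f" "\<And>x. f x \<in> B \<longleftrightarrow> x \<in> A"
  shows "B = f ` A"
proof (intro set_eqI)
  fix y
  obtain x where "y = f x"
    using assms(1) by (rule surjE)
  then show "y \<in> B \<longleftrightarrow> y \<in> f ` A"
    using assms(2) by blast
qed

section \<open>Cells, their faces, closures and boundaries\<close>

lemma cell_vertices_affine_image:
  assumes "affine_transformation T"
  shows "cell_vertices (T ` C) = T ` cell_vertices C"
proof (rule surj_image_eqI)
  show "surj T"
    using bij_affine_transformation[OF assms] by (rule bij_is_surj)
  show "T x \<in> cell_vertices (T ` C) \<longleftrightarrow> x \<in> cell_vertices C" for x
    by (simp add: cell_vertices_def extreme_point_of_affine_image[OF assms])
qed

lemma convex_hull_cell_vertices:
  assumes "is_cell k C"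
  shows "convex hull cell_vertices C = C"
  using assms by (auto simp: is_cell_def simplex cell_vertices_convex_hull)

text \<open>A cell is the convex hull of its vertices and \<open>T\<close> commutes with convex
  hulls, so the condition on vertex sets becomes one on point sets.\<close>

lemma maps_cell_iff:
  assumes "affine_transformation T" "is_cell k C" "is_cell l C'"
  shows "maps_cell T C C' \<longleftrightarrow> C' = T ` C"
proof
  assume "maps_cell T C C'"
  then have "convex hull (T ` cell_vertices C) = convex hull cell_vertices C'"
    by (simp add: maps_cell_def)
  then show "C' = T ` C"
    using assms by (simp add: convex_hull_affine_image convex_hull_cell_vertices)
qed (simp add: maps_cell_def cell_vertices_affine_image[OF assms(1)])

lemma is_cell_affine_image:
  assumes "affine_transformation T" "is_cell k C"
  shows "is_cell k (T ` C)"
proof -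
  obtain V where V: "\<not> affine_dependent V" "int (card V) = int k + 1" "C = convex hull V"
    using assms(2) by (auto simp: is_cell_def simplex)
  have inj: "inj T"
    using bij_affine_transformation[OF assms(1)] by (rule bij_is_inj)
  \<comment> \<open>Affine independence amounts to finiteness and \<open>aff_dim\<close> being one
    less than \<open>card\<close>; the injective \<open>T\<close> preserves all of these.\<close>
  have "\<not> affine_dependent (T ` V)"
    using V(1) aff_dim_affine_image[OF assms(1), of V] card_image[OF inj_on_subset[OF inj]]
    by (simp add: affine_independent_iff_card)
  moreover have "card (T ` V) = card V"
    using inj by (simp add: card_image inj_on_subset)
  ultimately show ?thesis
    using assms(2) V(2,3) convex_hull_affine_image[OF assms(1), of V]
    unfolding is_cell_def simplex_def by metis
qed

lemma is_cell_face_affine_image: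
  assumes "affine_transformation T" "is_cell_face r F C"
  shows "is_cell_face r (T ` F) (T ` C)"
  using assms(2) is_cell_affine_image[OF assms(1)]
  by (simp add: is_cell_face_def cell_vertices_affine_image[OF assms(1)] image_mono)

text \<open>Abstracting the dimension bound to \<open>P\<close> lets one argument serve both closure
  and boundary.\<close>

lemma Union_cell_faces_affine_image_subset:
  assumes "affine_transformation T"
  shows "T ` \<Union>{F. \<exists>r. P r \<and> is_cell_face r F C} \<subseteq> \<Union>{F. \<exists>r. P r \<and> is_cell_face r F (T ` C)}"
  using is_cell_face_affine_image[OF assms] by blast

text \<open>The missing inclusion is the previous lemma for \<open>inv T\<close> and the image of
  \<open>C\<close>, pushed forward again by \<open>T\<close>.\<close>

lemma Union_cell_faces_affine_image:
  assumes "affine_transformation T"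
  shows "\<Union>{F. \<exists>r. P r \<and> is_cell_face r F (T ` C)} = T ` \<Union>{F. \<exists>r. P r \<and> is_cell_face r F C}"
    (is "?L = T ` ?R")
proof
  have bij: "bij T"
    using assms by (rule bij_affine_transformation)
  have "inv T ` ?L \<subseteq> ?R"
    using Union_cell_faces_affine_image_subset[OF affine_transformation_inv[OF assms], of P "T ` C"]
    by (simp only: image_inv_f_f[OF bij_is_inj[OF bij]])
  then have "T ` inv T ` ?L \<subseteq> T ` ?R"
    by (rule image_mono)
  then show "?L \<subseteq> T ` ?R"
    by (simp only: image_f_inv_f[OF bij_is_surj[OF bij]])
qed (rule Union_cell_faces_affine_image_subset[OF assms])

lemma cell_parts_affine_image:
  assumes "affine_transformation T"
  shows "cell_closure (T ` C) = T ` cell_closure C"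
    and "cell_boundary (T ` C) = T ` cell_boundary C"
  unfolding cell_closure_def cell_boundary_def aff_dim_affine_image[OF assms]
  by (rule Union_cell_faces_affine_image[OF assms])+

section \<open>The parts of a geometry\<close>

text \<open>The definition keeps the points that lie on the cell boundary for a single index. As the
  list has no repetitions, a single index is the same as a single cell.\<close>

lemma geom_boundary_conv:
  assumes "distinct g"
  shows "geom_boundary g = {x. \<exists>!C. C \<in> set g \<and> x \<in> cell_boundary C}"
proof (intro set_eqI iffI)
  fix x
  assume x: "x \<in> geom_boundary g"
  then obtain i where i: "i < length g" "x \<in> cell_boundary (g ! i)"
    unfolding geom_boundary_def by blast
  have no: "x \<notin> cell_boundary (g ! k)"
    if "j < k" "k < length g" "x \<in> cell_boundary (g ! j)" for j k
  proof -
    have "j < length g" "k \<in> {j<..<length g}"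
      using that by auto
    with x that(3) show ?thesis
      unfolding geom_boundary_def by blast
  qed
  have "C = g ! i" if C: "C \<in> set g" "x \<in> cell_boundary C" for C
  proof -
    obtain j where j: "j < length g" "C = g ! j"
      using C(1) by (auto simp: in_set_conv_nth)
    show ?thesis
      \<comment> \<open>The definition subtracts only pairs in increasing order, so
        \<open>no\<close> is needed both ways round.\<close>
      using no[of i j] no[of j i] i j C(2) by (cases i j rule: linorder_cases) auto
  qed
  then show "x \<in> {x. \<exists>!C. C \<in> set g \<and> x \<in> cell_boundary C}"
    using i nth_mem by blast
next
  fix x
  assume "x \<in> {x. \<exists>!C. C \<in> set g \<and> x \<in> cell_boundary C}"
  then have ex: "\<exists>!C. C \<in> set g \<and> x \<in> cell_boundary C"
    by simp
  then obtain i where i: "i < length g" "x \<in> cell_boundary (g ! i)"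
    by (auto simp: in_set_conv_nth)
  have "x \<notin> cell_boundary (g ! k)"
    if "j < k" "k < length g" "x \<in> cell_boundary (g ! j)" for j k
  proof
    assume "x \<in> cell_boundary (g ! k)"
    moreover have "g ! j \<in> set g" "g ! k \<in> set g"
      using that by auto
    ultimately have "g ! j = g ! k"
      using ex that(3) by blast
    with that assms show False
      by (simp add: nth_eq_iff_index_eq)
  qed
  with i show "x \<in> geom_boundary g"
    by (auto simp: geom_boundary_def)
qed

lemma UN_nth: "(\<Union>i<length xs. f (xs ! i)) = (\<Union>x\<in>set xs. f x)"
  by (simp add: set_conv_nth) blast

lemma geom_interior_conv: "geom_interior g = (\<Union>C\<in>set g. cell_closure C) - geom_boundary g"
  by (simp add: geom_interior_def UN_nth)

lemma geom_exterior_conv: "geom_exterior g = - (\<Union>C\<in>set g. cell_closure C)"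
  unfolding geom_exterior_def UN_nth[symmetric] cell_exterior_def by blast

text \<open>Applied with \<open>image T\<close> as \<open>f\<close>: distinct cells have distinct
  images, so uniqueness of a cell is transported.\<close>

lemma ex1_image_iff:
  assumes "inj f"
  shows "(\<exists>!y. y \<in> f ` A \<and> P y) \<longleftrightarrow> (\<exists>!x. x \<in> A \<and> P (f x))"
proof
  assume "\<exists>!y. y \<in> f ` A \<and> P y"
  then show "\<exists>!x. x \<in> A \<and> P (f x)"
    by (metis assms imageE image_eqI injD)
next
  assume "\<exists>!x. x \<in> A \<and> P (f x)"
  then show "\<exists>!y. y \<in> f ` A \<and> P y"
    by blast
qed

text \<open>The two conditions of affine equivalence give one inclusion each. Only sets of cells are
  compared, since the two lists may be ordered differently.\<close>

lemma set_affine_equivalent: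
  assumes "affine_transformation T" "geometry g" "geometry g'" "affine_equivalent_under T g g'"
  shows "set g' = image T ` set g"
proof -
  have cell: "\<exists>k. is_cell k C" if "C \<in> set g \<union> set g'" for C
    using assms that by (auto simp: geometry_def)
  have fwd: "T ` C \<in> set g'" if C: "C \<in> set g" for C
  proof -
    obtain C' where "C' \<in> set g'" "maps_cell T C C'"
      using assms(4) C unfolding affine_equivalent_under_def by blast
    then show ?thesis
      using C cell[of C] cell[of C'] maps_cell_iff[OF assms(1)] by auto
  qed
  have bwd: "C' \<in> image T ` set g" if C': "C' \<in> set g'" for C'
  proof -
    obtain C where C: "C \<in> set g" "maps_cell (inv T) C' C"
      using assms(4) C' unfolding affine_equivalent_under_def by blast
    then have "C = inv T ` C'"
      using C' cell[of C] cell[of C'] maps_cell_iff[OF affine_transformation_inv[OF assms(1)]] by auto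
    then have "C' = T ` C"
      using bij_affine_transformation[OF assms(1)] by (simp add: bij_is_surj image_f_inv_f)
    with C(1) show ?thesis
      by blast
  qed
  show ?thesis
    using fwd bwd by blast
qed

lemma geom_part_affine_equivalent:
  assumes T: "affine_transformation T" and g: "geometry g" "geometry g'"
    and "affine_equivalent_under T g g'"
  shows "geom_part i g' = T ` geom_part i g"
proof -
  have set: "set g' = image T ` set g"
    using assms by (rule set_affine_equivalent)
  have bij: "bij T"
    using T by (rule bij_affine_transformation)
  have inj: "inj T"
    using bij by (rule bij_is_inj)
  have cl: "(\<Union>C\<in>set g'. cell_closure C) = T ` (\<Union>C\<in>set g. cell_closure C)"
    by (simp add: set cell_parts_affine_image[OF T] image_UN)
  have "inj (image T)"
    using inj by (simp add: inj_image_eq_iff inj_on_def)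
  then have "T x \<in> geom_boundary g' \<longleftrightarrow> x \<in> geom_boundary g" for x
    using g inj
    by (simp add: geometry_def geom_boundary_conv set ex1_image_iff cell_parts_affine_image[OF T]
        inj_image_mem_iff)
  then have bd: "geom_boundary g' = T ` geom_boundary g"
    using surj_image_eqI[OF bij_is_surj[OF bij]] by blast
  \<comment> \<open>The exterior is a complement, so surjectivity of \<open>T\<close> matters as
    well; \<open>Compl_UN\<close> is removed so that the union stays visible for
    \<open>cl\<close>.\<close>
  show ?thesis
    by (simp add: geom_part_def geom_interior_conv geom_exterior_conv cl bd
        image_set_diff[OF inj] bij_image_Compl_eq[OF bij]
        del: Compl_UN)
qed

section \<open>Dimension of an intersection\<close>

lemma contains_open_of_dim_affine_image:
  assumes T: "affine_transformation T" and "contains_open_of_dim S k"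
  shows "contains_open_of_dim (T ` S) k"
proof -
  obtain A W where A: "affine A" "aff_dim A = int k"
    and W: "open W" "A \<inter> W \<noteq> {}" "A \<inter> W \<subseteq> S"
    using assms(2) unfolding contains_open_of_dim_def openin_open by blast
  have inj: "inj T"
    using bij_affine_transformation[OF T] by (rule bij_is_inj)
  \<comment> \<open>By injectivity this image is the intersection of the images of \<open>A\<close>
    and \<open>W\<close>, the latter being open.\<close>
  have "openin (top_of_set (T ` A)) (T ` (A \<inter> W))"
    using open_affine_image[OF T W(1)] by (auto simp: image_Int[OF inj] openin_open)
  then show ?thesis
    unfolding contains_open_of_dim_def
    using A W affine_affine_image[OF T A(1)] aff_dim_affine_image[OF T, of A]
    by (intro exI[of _ "T ` A"] exI[of _ "T ` (A \<inter> W)"]) auto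
qed

text \<open>\<open>T\<close> and \<open>inv T\<close> show that both sets satisfy
  \<open>contains_open_of_dim\<close> for the same numbers, hence the \<open>GREATEST\<close> values
  agree; emptiness is preserved too.\<close>

lemma intersection_dim_affine_image:
  assumes T: "affine_transformation T"
  shows "intersection_dim (T ` S) = intersection_dim S"
proof -
  have "inv T ` T ` S = S"
    using bij_affine_transformation[OF T] by (simp add: bij_is_inj image_inv_f_f)
  then have "contains_open_of_dim (T ` S) = contains_open_of_dim S"
    using contains_open_of_dim_affine_image[OF T]
      contains_open_of_dim_affine_image[OF affine_transformation_inv[OF T], of "T ` S"] by auto
  then show ?thesis
    by (simp add: intersection_dim_def)
qed

theorem proposition3p3:
  fixes g1 g2 g1' g2' :: "(real^'n) set list"
  assumes "CARD('n) \<in> {2, 3}"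
    and "geometry g1" and "geometry g2" and "geometry g1'" and "geometry g2'"
    and "affine_equivalent_pairs (g1, g2) (g1', g2')"
  shows "topological_relationship g1 g2 = topological_relationship g1' g2'"
proof -
  obtain T where T: "affine_transformation T"
    and eq: "affine_equivalent_under T g1 g1'" "affine_equivalent_under T g2 g2'"
    using assms(6) by (auto simp: affine_equivalent_pairs_def)
  \<comment> \<open>Here it is essential that the same \<open>T\<close> serves both geometries;
    injectivity lets the image distribute over the intersection.\<close>
  have "geom_part i g1' \<inter> geom_part j g2' = T ` (geom_part i g1 \<inter> geom_part j g2)" for i j
    using geom_part_affine_equivalent[OF T] assms(2-5) eq
      bij_is_inj[OF bij_affine_transformation[OF T]] by (simp add: image_Int)
  then show ?thesis
    by (simp add: topological_relationship_def intersection_dim_affine_image[OF T])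
qed

end
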